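(* Let $Z$ be a positive random variable with continuous distribution function $G(x)=\mathbb{P}(Z\le x)$ satisfying $G(x)=\lambda x(1+o(1))$ as $x\downarrow0$, for some $\lambda>0$. Let $(s_n)_{n\in\mathbb{N}}$ be a sequence in $(0,\infty)$ with $s_n\log n\to\gamma\in[0,\infty)$, and let the edge weights of the complete graph $K_n$ satisfy $X_e\overset{d}{=}Z^{s_n}$. Then, for every $\epsilon>0$, \[ (1-\epsilon)e^{-\gamma}\le W_n\le 1+\epsilon\quad\text{and}\quad H_n\le e^{2\gamma}\quad\text{with high probability.} \]
   Context: For each $n$, let $K_n$ be the complete graph with vertex set $[n]=\{1,\dots,n\}$ and edge set $\mathrm{E}_n$. The edge weights $(X_e)_{e\in \mathrm{E}_n}$ are positive i.i.d. random variables with a continuous distribution function. The weight of a path $p$ is $w(p)=\sum_{e\in p}X_e$. Let $\mathcal{S}_{1,2}$ be the set of self-avoiding paths between vertex $1$ and vertex $2$. $W_n=\min_{p\in\mathcal{S}_{1,2}}w(p)$ is the weight of the (almost surely unique) minimal weight path, and the hopcount $H_n$ is its number of edges. A sequence of events $(A_n)$ occurs with high probability if $\mathbb{P}(A_n)\to1$ as $n\to\infty$. *)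

theory Defs
  imports "HOL-Probability.Probability"
begin

definition K_edges :: "nat \<Rightarrow> nat set set" where
  "K_edges n = {e. e \<subseteq> {1..n} \<and> card e = 2}"

text \<open>A path is given by the list of its successive vertices.\<close>

definition path_edges :: "'v list \<Rightarrow> 'v set list" where
  "path_edges p = map (\<lambda>(u, v). {u, v}) (zip p (tl p))"

definition self_avoiding_paths :: "nat \<Rightarrow> nat \<Rightarrow> nat \<Rightarrow> nat list set" where
  "self_avoiding_paths n u v =
    {p. p \<noteq> [] \<and> hd p = u \<and> last p = v \<and> distinct p \<and> set p \<subseteq> {1..n} \<and>
        set (path_edges p) \<subseteq> K_edges n}"

definition path_weight :: "('v set \<Rightarrow> real) \<Rightarrow> 'v list \<Rightarrow> real" where
  "path_weight x p = (\<Sum>e\<leftarrow>path_edges p. x e)"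

text \<open>The argument \<open>x\<close> below is a realisation of the edge weights of the complete graph on
  \<open>{1..n}\<close>. The minima are meaningful for \<open>n \<ge> 2\<close>, where there is a path from 1 to 2.\<close>

definition passage_weight :: "nat \<Rightarrow> (nat set \<Rightarrow> real) \<Rightarrow> real" where
  "passage_weight n x = Min (path_weight x ` self_avoiding_paths n 1 2)"

text \<open>When several paths attain the minimum (an event of probability zero for independent weights
  with continuous distribution functions), \<^const>\<open>arg_min_on\<close> selects one of them,
  depending only on the set of minimisers.\<close>

definition hopcount :: "nat \<Rightarrow> (nat set \<Rightarrow> real) \<Rightarrow> nat" where
  "hopcount n x = length (path_edges (arg_min_on (path_weight x) (self_avoiding_paths n 1 2)))"

text \<open>A set that is not measurable has \<^const>\<open>measure\<close> 0, so the following entails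
  measurability of \<open>A n\<close> for all large \<open>n\<close>.\<close>

definition with_high_probability :: "(nat \<Rightarrow> 'a measure) \<Rightarrow> (nat \<Rightarrow> 'a set) \<Rightarrow> bool" where
  "with_high_probability M A \<longleftrightarrow> (\<lambda>n. measure (M n) (A n)) \<longlonglongrightarrow> 1"

end

theory Submission imports Defs
begin

text \<open>
  The upper bound comes from the direct edge: \<open>W \<le> X\<^sub>1\<^sub>2\<close>, and \<open>Z powr s \<rightarrow> 1\<close> in probability as
  \<open>s \<rightarrow> 0\<close>. For the lower bound, every path uses one of the \<open>n - 1\<close> edges at vertex 1,
  whose smallest weight is about \<open>n powr (- s) \<rightarrow> exp (- \<gamma>)\<close>. Likewise the smallest of all the
  edge weights is about \<open>n powr (- 2 * s) \<rightarrow> exp (- 2 * \<gamma>)\<close>, so that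
  \<open>H * (1 - \<delta>) * exp (- 2 * \<gamma>) \<le> W \<le> 1 + \<delta>\<close>. As \<open>H\<close> is an integer, this forces
  \<open>H \<le> exp (2 * \<gamma>)\<close> exactly once \<open>\<delta>\<close> is small. Both lower
  bounds on edge weights are union bounds over the edges.
\<close>

section \<open>Edges and self-avoiding paths of the complete graph\<close>

lemma finite_K_edges: "finite (K_edges n)"
  by (rule finite_subset[of _ "Pow {1..n}"]) (auto simp: K_edges_def)

text \<open>Only the power of \<open>n\<close> matters in the union bound, so the exact count
  \<open>n * (n - 1) div 2\<close> is relaxed to a square.\<close>

lemma card_K_edges_le: "card (K_edges n) \<le> n\<^sup>2"
proof -
  have "card (K_edges n) = n * (n - 1) div 2"
    using n_subsets[of "{1..n}" 2] unfolding K_edges_def choose_two by simp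
  also have "\<dots> \<le> n * (n - 1)"
    by (rule div_le_dividend)
  also have "\<dots> \<le> n\<^sup>2"
    by (simp add: power2_eq_square)
  finally show ?thesis .
qed

lemma card_K_edges_incident_le: "card {e \<in> K_edges n. v \<in> e} \<le> n"
proof -
  have "{e \<in> K_edges n. v \<in> e} \<subseteq> (\<lambda>j. {v, j}) ` {1..n}"
    unfolding K_edges_def card_2_iff by fastforce
  then have "card {e \<in> K_edges n. v \<in> e} \<le> card ((\<lambda>j. {v, j}) ` {1..n})"
    by (intro card_mono) auto
  also have "\<dots> \<le> n"
    using card_image_le[of "{1..n}" "\<lambda>j. {v, j}"] by simp
  finally show ?thesis .
qed

lemma finite_self_avoiding_paths: "finite (self_avoiding_paths n u v)"
  by (rule finite_subset[OF _ finite_subset_distinct[of "{1..n}"]])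
     (auto simp: self_avoiding_paths_def)

lemma edge_in_self_avoiding_paths:
  assumes "2 \<le> n"
  shows "[1, 2] \<in> self_avoiding_paths n 1 2"
  using assms by (auto simp: self_avoiding_paths_def path_edges_def K_edges_def)

text \<open>Distinct endpoints force the path to have a first edge, which contains \<open>u\<close>;
  the rest of the path contributes a nonnegative weight.\<close>

lemma first_edge_weight_le:
  assumes p: "p \<in> self_avoiding_paths n u v" and "u \<noteq> v"
    and nonneg: "\<And>e. e \<in> K_edges n \<Longrightarrow> 0 \<le> x e"
  obtains e where "e \<in> K_edges n" "u \<in> e" "x e \<le> path_weight x p"
proof -
  obtain w q where pq: "p = u # w # q"
    using p \<open>u \<noteq> v\<close> unfolding self_avoiding_paths_def
    by (cases p; cases "tl p") auto
  have "{u, w} \<in> K_edges n" "set (path_edges (w # q)) \<subseteq> K_edges n"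
    using p unfolding pq by (auto simp: self_avoiding_paths_def path_edges_def)
  moreover from this have "0 \<le> path_weight x (w # q)"
    unfolding path_weight_def by (intro sum_list_nonneg) (use nonneg in auto)
  moreover have "path_weight x p = x {u, w} + path_weight x (w # q)"
    by (simp add: pq path_weight_def path_edges_def)
  ultimately show thesis
    by (intro that[of "{u, w}"]) auto
qed

lemma length_path_edges_le:
  assumes p: "p \<in> self_avoiding_paths n u v" and "\<And>e. e \<in> K_edges n \<Longrightarrow> b \<le> x e"
  shows "b * real (length (path_edges p)) \<le> path_weight x p"
proof -
  have "set (path_edges p) \<subseteq> K_edges n"
    using p by (simp add: self_avoiding_paths_def)
  then have "(\<Sum>e\<leftarrow>path_edges p. b) \<le> path_weight x p"
    unfolding path_weight_def by (intro sum_list_mono) (use assms(2) in auto)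
  then show ?thesis
    by (simp add: sum_list_triv mult.commute)
qed

text \<open>The deterministic core: three conditions on a realisation of the weights yield all the
  bounds. The path \<open>[1, 2]\<close> caps the minimum by \<open>u\<close>, and the minimising
  path pays at least \<open>b\<close> per edge out of this budget, which limits its length.\<close>

lemma passage_weight_hopcount_bounds:
  assumes n: "2 \<le> n" and b: "0 \<le> b"
    and edges: "\<And>e. e \<in> K_edges n \<Longrightarrow> b \<le> x e"
    and star: "\<And>e. e \<in> K_edges n \<Longrightarrow> 1 \<in> e \<Longrightarrow> a \<le> x e"
    and direct: "x {1, 2} \<le> u"
  shows "a \<le> passage_weight n x" "passage_weight n x \<le> u" "b * real (hopcount n x) \<le> u"
proof -
  let ?S = "self_avoiding_paths n 1 2"
  have fin: "finite ?S" and ne: "?S \<noteq> {}"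
    using finite_self_avoiding_paths edge_in_self_avoiding_paths[OF n] by auto
  have le_u: "path_weight x [1, 2] \<le> u"
    using direct by (simp add: path_weight_def path_edges_def)
  show "a \<le> passage_weight n x"
    unfolding passage_weight_def
  proof (rule Min.boundedI)
    fix y assume "y \<in> path_weight x ` ?S"
    then obtain p where p: "p \<in> ?S" "y = path_weight x p"
      by blast
    \<comment> \<open>Here \<open>b\<close> serves only to make all weights nonnegative; the bound
      \<open>a\<close> enters through \<open>star\<close>.\<close>
    obtain e where "e \<in> K_edges n" "1 \<in> e" "x e \<le> path_weight x p"
      by (rule first_edge_weight_le[OF p(1), of x]) (use edges b in force)+
    then show "a \<le> y"
      using star[of e] p(2) by simp
  qed (use fin ne in auto)
  show "passage_weight n x \<le> u"
    unfolding passage_weight_def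
    using fin edge_in_self_avoiding_paths[OF n] le_u by (intro Min.coboundedI[THEN order_trans]) auto
  let ?p = "arg_min_on (path_weight x) ?S"
  have "?p \<in> ?S" "path_weight x ?p \<le> path_weight x [1, 2]"
    using arg_min_if_finite[OF fin ne, of "path_weight x"] edge_in_self_avoiding_paths[OF n]
    by (auto simp: not_less)
  then show "b * real (hopcount n x) \<le> u"
    using length_path_edges_le[of ?p n 1 2 b x] edges le_u unfolding hopcount_def by fastforce
qed

section \<open>Measurability of the passage weight and the hopcount\<close>

text \<open>The selected index is a function of the set of minimisers alone. That random set has
  finitely many possible values, each taken on a measurable event, so any choice from it is
  measurable, ties included.\<close>

lemma measurable_arg_min_on:
  fixes f :: "'i \<Rightarrow> 'a \<Rightarrow> real"
  assumes "finite S" and "\<And>i. i \<in> S \<Longrightarrow> f i \<in> borel_measurable M"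
  shows "(\<lambda>\<omega>. arg_min_on (\<lambda>i. f i \<omega>) S) \<in> M \<rightarrow>\<^sub>M count_space UNIV"
proof -
  define g where "g \<omega> = {i \<in> S. \<forall>j\<in>S. f i \<omega> \<le> f j \<omega>}" for \<omega>
  have "g \<in> M \<rightarrow>\<^sub>M count_space (Pow S)"
  proof (subst measurable_count_space_eq2)
    show "finite (Pow S)"
      using assms(1) by simp
    have "g -` {T} \<inter> space M \<in> sets M" if "T \<in> Pow S" for T
    proof -
      have "g -` {T} \<inter> space M =
          {\<omega> \<in> space M. \<forall>i\<in>S. (\<forall>j\<in>S. f i \<omega> \<le> f j \<omega>) \<longleftrightarrow> i \<in> T}"
        using that unfolding g_def by blast
      also have "\<dots> \<in> sets M"
        using assms by (intro sets.sets_Collect_finite_All sets.sets_Collect) auto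
      finally show ?thesis .
    qed
    then show "g \<in> space M \<rightarrow> Pow S \<and> (\<forall>T\<in>Pow S. g -` {T} \<inter> space M \<in> sets M)"
      by (auto simp: g_def)
  qed
  then have "(\<lambda>\<omega>. SOME i. i \<in> g \<omega>) \<in> M \<rightarrow>\<^sub>M count_space UNIV"
    by (rule measurable_compose) simp
  moreover have "arg_min_on (\<lambda>i. f i \<omega>) S = (SOME i. i \<in> g \<omega>)" for \<omega>
    unfolding arg_min_on_def arg_min_def is_arg_min_def g_def
    by (rule arg_cong[of _ _ Eps]) (auto simp: not_less)
  ultimately show ?thesis
    by simp
qed

context
  fixes M :: "'a measure" and X :: "nat set \<Rightarrow> 'a \<Rightarrow> real" and n :: nat
  assumes X[measurable]: "\<And>e. e \<in> K_edges n \<Longrightarrow> X e \<in> borel_measurable M"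
begin

lemma measurable_path_weight:
  assumes "p \<in> self_avoiding_paths n u v"
  shows "(\<lambda>\<omega>. path_weight (\<lambda>e. X e \<omega>) p) \<in> borel_measurable M"
proof -
  have "set (path_edges p) \<subseteq> K_edges n"
    using assms by (simp add: self_avoiding_paths_def)
  \<comment> \<open>Indexing the list by position turns its sum into a finite sum of measurable
    functions.\<close>
  then have "(\<lambda>\<omega>. \<Sum>i<length (path_edges p). X (path_edges p ! i) \<omega>) \<in> borel_measurable M"
    by (intro borel_measurable_sum X) (auto dest: nth_mem)
  then show ?thesis
    by (simp add: path_weight_def sum_list_sum_nth atLeast0LessThan)
qed

lemma measurable_passage_weight:
  "(\<lambda>\<omega>. passage_weight n (\<lambda>e. X e \<omega>)) \<in> borel_measurable M"
  unfolding passage_weight_def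
  by (intro borel_measurable_Min finite_self_avoiding_paths measurable_path_weight)

lemma measurable_hopcount:
  "(\<lambda>\<omega>. hopcount n (\<lambda>e. X e \<omega>)) \<in> M \<rightarrow>\<^sub>M count_space UNIV"
proof -
  have "(\<lambda>\<omega>. arg_min_on (path_weight (\<lambda>e. X e \<omega>)) (self_avoiding_paths n 1 2))
      \<in> M \<rightarrow>\<^sub>M count_space UNIV"
    by (rule measurable_arg_min_on[OF finite_self_avoiding_paths measurable_path_weight])
  then show ?thesis
    unfolding hopcount_def by (rule measurable_compose) simp
qed

end

section \<open>The union bound over edges\<close>

text \<open>Three kinds of bad event are excluded: a weight below \<open>a\<close> on one of at most
  \<open>n\<close> edges at vertex 1, a weight below \<open>b\<close> on one of at most
  \<open>n^2\<close> edges, and a weight above \<open>u\<close> on the single edge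
  \<open>{1, 2}\<close>. Hypothesis \<open>h\<close> converts the hopcount inequality into the final
  bound.\<close>

lemma prob_passage_weight_hopcount_ge:
  assumes "prob_space M" and n: "2 \<le> n" and "0 \<le> b"
    and X[measurable]: "\<And>e. e \<in> K_edges n \<Longrightarrow> X e \<in> borel_measurable M"
    and a: "\<And>e. e \<in> K_edges n \<Longrightarrow> measure M {\<omega> \<in> space M. X e \<omega> < a} \<le> pa"
    and b: "\<And>e. e \<in> K_edges n \<Longrightarrow> measure M {\<omega> \<in> space M. X e \<omega> < b} \<le> pb"
    and u: "\<And>e. e \<in> K_edges n \<Longrightarrow> measure M {\<omega> \<in> space M. u < X e \<omega>} \<le> pu"
    and h: "\<And>k. b * real k \<le> u \<Longrightarrow> real k \<le> h"
    and "0 \<le> pa" "0 \<le> pb"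
  shows "1 - (real n * pa + (real n)\<^sup>2 * pb + pu) \<le> measure M {\<omega> \<in> space M.
           a \<le> passage_weight n (\<lambda>e. X e \<omega>) \<and> passage_weight n (\<lambda>e. X e \<omega>) \<le> u \<and>
           real (hopcount n (\<lambda>e. X e \<omega>)) \<le> h}" (is "_ \<le> measure M ?A")
proof -
  interpret prob_space M by fact
  let ?S = "{e \<in> K_edges n. 1 \<in> e}"
  have e12: "{1, 2} \<in> K_edges n"
    using n by (auto simp: K_edges_def)
  have finS: "finite ?S"
    using finite_K_edges by simp
  define BA where "BA = (\<Union>e\<in>?S. {\<omega> \<in> space M. X e \<omega> < a})"
  define BB where "BB = (\<Union>e\<in>K_edges n. {\<omega> \<in> space M. X e \<omega> < b})"
  define BU where "BU = {\<omega> \<in> space M. u < X {1, 2} \<omega>}"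
  note [measurable] = measurable_passage_weight[OF X] measurable_hopcount[OF X] X[OF e12]
  have A: "?A \<in> sets M"
    by measurable
  have BA: "BA \<in> sets M"
    unfolding BA_def using finS by (intro sets.finite_UN) auto
  have BB: "BB \<in> sets M"
    unfolding BB_def using finite_K_edges by (intro sets.finite_UN) auto
  have BU: "BU \<in> sets M"
    unfolding BU_def by measurable
  have "prob BA \<le> (\<Sum>e\<in>?S. prob {\<omega> \<in> space M. X e \<omega> < a})"
    unfolding BA_def using finS by (intro finite_measure_subadditive_finite) auto
  also have "\<dots> \<le> real (card ?S) * pa"
    using a by (intro sum_bounded_above) auto
  also have "\<dots> \<le> real n * pa"
    using card_K_edges_incident_le[of n 1] \<open>0 \<le> pa\<close> by (intro mult_right_mono) auto
  finally have 1: "prob BA \<le> real n * pa" .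
  have "prob BB \<le> (\<Sum>e\<in>K_edges n. prob {\<omega> \<in> space M. X e \<omega> < b})"
    unfolding BB_def using finite_K_edges by (intro finite_measure_subadditive_finite) auto
  also have "\<dots> \<le> real (card (K_edges n)) * pb"
    using b by (intro sum_bounded_above) auto
  also have "\<dots> \<le> (real n)\<^sup>2 * pb"
    using card_K_edges_le[of n] \<open>0 \<le> pb\<close>
    by (intro mult_right_mono) (simp_all flip: of_nat_power)
  finally have 2: "prob BB \<le> (real n)\<^sup>2 * pb" .
  have 3: "prob BU \<le> pu"
    unfolding BU_def by (rule u[OF e12])
  \<comment> \<open>Off the three bad events the deterministic bounds apply.\<close>
  have "space M - ?A \<subseteq> BA \<union> BB \<union> BU"
  proof
    fix \<omega> assume \<omega>: "\<omega> \<in> space M - ?A"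
    show "\<omega> \<in> BA \<union> BB \<union> BU"
    proof (rule ccontr)
      assume "\<omega> \<notin> BA \<union> BB \<union> BU"
      then have "\<And>e. e \<in> K_edges n \<Longrightarrow> b \<le> X e \<omega>"
        "\<And>e. e \<in> K_edges n \<Longrightarrow> 1 \<in> e \<Longrightarrow> a \<le> X e \<omega>" "X {1, 2} \<omega> \<le> u"
        using \<omega> unfolding BA_def BB_def BU_def by (auto simp: not_less)
      from passage_weight_hopcount_bounds[where x = "\<lambda>e. X e \<omega>", OF n \<open>0 \<le> b\<close> this] h \<omega> show False
        by auto
    qed
  qed
  then have "prob (space M - ?A) \<le> prob (BA \<union> BB \<union> BU)"
    using BA BB BU by (intro finite_measure_mono) auto
  also have "\<dots> \<le> prob BA + prob BB + prob BU"
    using measure_Un_le[of "BA \<union> BB" M BU] measure_Un_le[of BA M BB] BA BB BU by auto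
  finally show ?thesis
    using prob_compl[OF A] 1 2 3 by linarith
qed

section \<open>Tails of the edge weights and their asymptotics\<close>

lemma measure_distr_eqD:
  assumes "distr M K f = distr N K g" "f \<in> M \<rightarrow>\<^sub>M K" "g \<in> N \<rightarrow>\<^sub>M K" "A \<in> sets K"
  shows "measure M (f -` A \<inter> space M) = measure N (g -` A \<inter> space N)"
  using assms by (metis measure_distr)

text \<open>Raising to a positive power is increasing on the positive reals, so both tails of
  \<open>Y\<close> at \<open>c\<close> are controlled by the distribution function of
  \<open>Z\<close> at the one point \<open>c powr (1 / s)\<close>.\<close>

lemma measure_powr_tails:
  fixes Z :: "'b \<Rightarrow> real"
  assumes "prob_space N" and [measurable]: "Z \<in> borel_measurable N" and pos: "AE \<omega> in N. 0 < Z \<omega>"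
    and [measurable]: "Y \<in> borel_measurable M"
    and eq: "distr M borel Y = distr N borel (\<lambda>\<omega>. Z \<omega> powr s)"
    and s: "0 < s" and c: "0 < c"
  shows "measure M {\<omega> \<in> space M. Y \<omega> < c} \<le> measure N {\<omega> \<in> space N. Z \<omega> \<le> c powr (1 / s)}"
    and "measure M {\<omega> \<in> space M. c < Y \<omega>} \<le> 1 - measure N {\<omega> \<in> space N. Z \<omega> \<le> c powr (1 / s)}"
proof -
  interpret prob_space N by fact
  \<comment> \<open>The equivalence needs \<open>0 < z\<close>, and \<open>Z\<close> is positive
    only almost surely; hence the comparisons below use monotonicity up to null sets.\<close>
  have iff: "z \<le> c powr (1 / s) \<longleftrightarrow> z powr s \<le> c" if "0 < z" for z
  proof -
    have "z \<le> c powr (1 / s) \<longleftrightarrow> z powr s \<le> (c powr (1 / s)) powr s"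
      using that s powr_mono2[of s z "c powr (1 / s)"] powr_less_mono2[of s "c powr (1 / s)" z]
      by (auto simp flip: not_less)
    then show ?thesis
      using s c by (simp add: powr_powr)
  qed
  have "measure M {\<omega> \<in> space M. Y \<omega> < c} = prob {\<omega> \<in> space N. Z \<omega> powr s < c}"
    using measure_distr_eqD[OF eq, of "{..<c}"] by (simp add: vimage_def Int_def conj_commute)
  also have "\<dots> \<le> prob {\<omega> \<in> space N. Z \<omega> \<le> c powr (1 / s)}"
    by (rule finite_measure_mono_AE) (use pos in \<open>auto simp: iff elim!: AE_mp\<close>)
  finally show "measure M {\<omega> \<in> space M. Y \<omega> < c} \<le> prob {\<omega> \<in> space N. Z \<omega> \<le> c powr (1 / s)}" .
  have "measure M {\<omega> \<in> space M. c < Y \<omega>} = prob {\<omega> \<in> space N. c < Z \<omega> powr s}"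
    using measure_distr_eqD[OF eq, of "{c<..}"] by (simp add: vimage_def Int_def conj_commute)
  also have "\<dots> \<le> prob {\<omega> \<in> space N. \<not> Z \<omega> \<le> c powr (1 / s)}"
    by (rule finite_measure_mono_AE) (use pos in \<open>auto simp: iff elim!: AE_mp\<close>)
  also have "\<dots> = 1 - prob {\<omega> \<in> space N. Z \<omega> \<le> c powr (1 / s)}"
    by (rule prob_neg) measurable
  finally show "measure M {\<omega> \<in> space M. c < Y \<omega>} \<le>
      1 - prob {\<omega> \<in> space N. Z \<omega> \<le> c powr (1 / s)}" .
qed

lemma tendsto_zero_of_mult_ln:
  fixes s :: "nat \<Rightarrow> real"
  assumes "(\<lambda>n. s n * ln (real n)) \<longlonglongrightarrow> \<gamma>"
  shows "s \<longlonglongrightarrow> 0"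
proof -
  have ln: "filterlim (\<lambda>n. ln (real n)) at_top sequentially"
    by (rule filterlim_compose[OF ln_at_top filterlim_real_sequentially])
  have "(\<lambda>n. s n * ln (real n) / ln (real n)) \<longlonglongrightarrow> 0"
    by (rule real_tendsto_divide_at_top[OF assms ln])
  \<comment> \<open>The logarithm vanishes at \<open>n = 1\<close>, so the cancellation is claimed
    from 2 onwards.\<close>
  moreover have "\<forall>\<^sub>F n in sequentially. s n * ln (real n) / ln (real n) = s n"
    using eventually_gt_at_top[of 1] by eventually_elim simp
  ultimately show ?thesis
    by (rule Lim_transform_eventually)
qed

text \<open>This is the source of the thresholds \<open>exp (- \<gamma>)\<close> and
  \<open>exp (- 2 * \<gamma>)\<close>. The product equals the exponential of
  \<open>(k * s n * ln n + ln c) / s n\<close>, whose numerator tends to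
  \<open>k * \<gamma> + ln c < 0\<close> while \<open>1 / s n\<close> tends to infinity.\<close>

lemma power_mult_powr_tendsto_zero:
  fixes s :: "nat \<Rightarrow> real"
  assumes s: "\<forall>\<^sub>F n in sequentially. 0 < s n" and lim: "(\<lambda>n. s n * ln (real n)) \<longlonglongrightarrow> \<gamma>"
    and c: "0 < c" "c < exp (- (real k * \<gamma>))"
  shows "(\<lambda>n. real n ^ k * c powr (1 / s n)) \<longlonglongrightarrow> 0"
proof -
  have s0: "filterlim s (at_right 0) sequentially"
    using tendsto_zero_of_mult_ln[OF lim] s by (intro tendsto_imp_filterlim_at_right) auto
  have inv: "filterlim (\<lambda>n. inverse (s n)) at_top sequentially"
    by (rule filterlim_compose[OF filterlim_inverse_at_top_right s0])
  have num: "(\<lambda>n. real k * (s n * ln (real n)) + ln c) \<longlonglongrightarrow> real k * \<gamma> + ln c"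
    by (intro tendsto_intros lim)
  have neg: "real k * \<gamma> + ln c < 0"
    using c ln_less_cancel_iff[of c "exp (- (real k * \<gamma>))"] by simp
  have "filterlim (\<lambda>n. (real k * (s n * ln (real n)) + ln c) * inverse (s n)) at_bot sequentially"
    by (rule filterlim_tendsto_neg_mult_at_bot[OF num neg inv])
  then have "(\<lambda>n. exp ((real k * (s n * ln (real n)) + ln c) * inverse (s n))) \<longlonglongrightarrow> 0"
    by (rule filterlim_compose[OF exp_at_bot])
  moreover have "\<forall>\<^sub>F n in sequentially.
      exp ((real k * (s n * ln (real n)) + ln c) * inverse (s n)) = real n ^ k * c powr (1 / s n)"
    using s eventually_gt_at_top[of 0]
  proof eventually_elim
    case (elim n)
    then have "(real k * (s n * ln (real n)) + ln c) * inverse (s n) =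
        real k * ln (real n) + 1 / s n * ln c"
      by (simp add: field_simps)
    then show ?case
      using elim c by (simp add: exp_add powr_def flip: exp_of_nat_mult)
        (simp add: exp_of_nat_mult)
  qed
  ultimately show ?thesis
    by (rule Lim_transform_eventually)
qed

text \<open>Near 0 the function \<open>G\<close> may be replaced by \<open>l * x\<close>, which
  reduces the claim to the previous limit.\<close>

lemma power_mult_cdf_powr_tendsto_zero:
  fixes s :: "nat \<Rightarrow> real" and G :: "real \<Rightarrow> real"
  assumes G: "G \<sim>[at_right 0] (\<lambda>x. l * x)"
    and s: "\<forall>\<^sub>F n in sequentially. 0 < s n" and lim: "(\<lambda>n. s n * ln (real n)) \<longlonglongrightarrow> \<gamma>" and "0 \<le> \<gamma>"
    and c: "0 < c" "c < exp (- (real k * \<gamma>))"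
  shows "(\<lambda>n. real n ^ k * G (c powr (1 / s n))) \<longlonglongrightarrow> 0"
proof -
  \<comment> \<open>The case \<open>k = 0\<close> of the previous limit, available since
    \<open>\<gamma> \<ge> 0\<close> gives \<open>c < 1\<close>, shows that the argument of
    \<open>G\<close> tends to 0; positivity makes the approach one-sided.\<close>
  have "c < exp (- (real 0 * \<gamma>))"
    using c \<open>0 \<le> \<gamma>\<close> by (simp add: less_le_trans)
  then have "(\<lambda>n. real n ^ 0 * c powr (1 / s n)) \<longlonglongrightarrow> 0"
    by (intro power_mult_powr_tendsto_zero[OF s lim \<open>0 < c\<close>])
  then have "filterlim (\<lambda>n. c powr (1 / s n)) (at_right 0) sequentially"
    using \<open>0 < c\<close> by (intro tendsto_imp_filterlim_at_right) auto
  with G have "(\<lambda>n. G (c powr (1 / s n))) \<sim>[sequentially] (\<lambda>n. l * c powr (1 / s n))"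
    by (rule asymp_equiv_compose')
  then have eq: "(\<lambda>n. real n ^ k * G (c powr (1 / s n))) \<sim>[sequentially]
      (\<lambda>n. real n ^ k * (l * c powr (1 / s n)))"
    by (intro asymp_equiv_intros)
  have "(\<lambda>n. l * (real n ^ k * c powr (1 / s n))) \<longlonglongrightarrow> l * 0"
    by (intro tendsto_intros power_mult_powr_tendsto_zero[OF s lim c])
  then have "(\<lambda>n. real n ^ k * (l * c powr (1 / s n))) \<longlonglongrightarrow> 0"
    by (simp add: mult.left_commute)
  then show ?thesis
    using asymp_equiv_symI[OF eq] tendsto_asymp_equiv_cong[OF eq] by simp
qed

text \<open>For \<open>c > 1\<close> the points \<open>c powr (1 / s n)\<close> run off to infinity,
  where a distribution function tends to 1.\<close>

lemma cdf_powr_tendsto_one: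
  fixes Z :: "'b \<Rightarrow> real"
  assumes "prob_space N" and [measurable]: "Z \<in> borel_measurable N"
    and s: "\<forall>\<^sub>F n in sequentially. 0 < s n" "s \<longlonglongrightarrow> 0" and c: "1 < c"
  shows "(\<lambda>n. measure N {\<omega> \<in> space N. Z \<omega> \<le> c powr (1 / s n)}) \<longlonglongrightarrow> 1"
proof -
  interpret prob_space N by fact
  interpret D: real_distribution "distr N borel Z"
    by (rule real_distribution_distr) simp
  have "filterlim s (at_right 0) sequentially"
    using s by (intro tendsto_imp_filterlim_at_right) auto
  then have "filterlim (\<lambda>n. inverse (s n)) at_top sequentially"
    by (rule filterlim_compose[OF filterlim_inverse_at_top_right])
  then have "filterlim (\<lambda>n. ln c * inverse (s n)) at_top sequentially"
    using c by (intro filterlim_tendsto_pos_mult_at_top[OF tendsto_const]) auto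
  then have "filterlim (\<lambda>n. exp (ln c * inverse (s n))) at_top sequentially"
    by (rule filterlim_compose[OF exp_at_top])
  then have "filterlim (\<lambda>n. c powr (1 / s n)) at_top sequentially"
    using c by (simp add: powr_def field_simps)
  then have "(\<lambda>n. cdf (distr N borel Z) (c powr (1 / s n))) \<longlonglongrightarrow> 1"
    by (rule filterlim_compose[OF D.cdf_lim_at_top_prob])
  then show ?thesis
    by (simp add: cdf_def measure_distr vimage_def Int_def conj_commute)
qed

section \<open>Integrality of the hopcount\<close>

text \<open>The first integer \<open>m\<close> above \<open>h\<close> lies at a positive distance
  from it, so a small enough relative error cannot lift an integer past \<open>h\<close>. This gives
  the bound on the hopcount without any loss in \<open>h\<close>.\<close>

lemma nat_le_of_le_mult_near_1:
  fixes h :: real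
  assumes "0 < h"
  obtains \<delta> where "0 < \<delta>" "\<delta> < 1"
    "\<And>k :: nat. (1 - \<delta>) * real k \<le> (1 + \<delta>) * h \<Longrightarrow> real k \<le> h"
proof -
  define m where "m = real (nat \<lfloor>h\<rfloor>) + 1"
  have m: "h < m"
    using assms by (simp add: m_def)
  \<comment> \<open>The inequality \<open>(1 + \<delta>) * h < (1 - \<delta>) * m\<close> means
    \<open>\<delta> * (m + h) < m - h\<close>; half the critical value is taken.\<close>
  define \<delta> where "\<delta> = (m - h) / (2 * (m + h))"
  have d: "0 < \<delta>" "\<delta> < 1" "(1 + \<delta>) * h < (1 - \<delta>) * m"
  proof -
    show "0 < \<delta>" "\<delta> < 1"
      using m assms by (simp_all add: \<delta>_def field_simps)
    have "m + h \<noteq> 0"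
      using m assms by simp
    then have "\<delta> * (m + h) = (m - h) / 2"
      unfolding \<delta>_def times_divide_eq_left by (rule nonzero_mult_divide_mult_cancel_right)
    then show "(1 + \<delta>) * h < (1 - \<delta>) * m"
      using m by (simp add: algebra_simps)
  qed
  have "real k \<le> h" if k: "(1 - \<delta>) * real k \<le> (1 + \<delta>) * h" for k :: nat
  proof -
    have "(1 - \<delta>) * real k < (1 - \<delta>) * m"
      using k d(3) by linarith
    then have "real k < m"
      using d(2) by simp
    then have "real k \<le> real (nat \<lfloor>h\<rfloor>)"
      unfolding m_def by simp
    also have "\<dots> \<le> h"
      using assms by (intro of_nat_floor) simp
    finally show ?thesis .
  qed
  with d show thesis
    by (intro that)
qed

section \<open>Choice of the thresholds and passage to the limit\<close>

theorem theorem1p3: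
  fixes N :: "'b measure" and Z :: "'b \<Rightarrow> real" and G :: "real \<Rightarrow> real"
    and l \<gamma> :: real and s :: "nat \<Rightarrow> real"
    and M :: "nat \<Rightarrow> 'a measure" and X :: "nat \<Rightarrow> nat set \<Rightarrow> 'a \<Rightarrow> real"
  assumes "prob_space N" and "Z \<in> borel_measurable N" and "AE \<omega> in N. 0 < Z \<omega>"
    and "\<And>x. G x = measure N {\<omega> \<in> space N. Z \<omega> \<le> x}"
    and "continuous_on UNIV G"
    and "0 < l" and "G \<sim>[at_right 0] (\<lambda>x. l * x)"
    and "\<And>n. 1 \<le> n \<Longrightarrow> 0 < s n"
    and "0 \<le> \<gamma>" and "(\<lambda>n. s n * ln (real n)) \<longlonglongrightarrow> \<gamma>"
    and "\<And>n. 1 \<le> n \<Longrightarrow> prob_space (M n)"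
    and "\<And>n. 1 \<le> n \<Longrightarrow> prob_space.indep_vars (M n) (\<lambda>_. borel) (X n) (K_edges n)"
    and "\<And>n e. 1 \<le> n \<Longrightarrow> e \<in> K_edges n \<Longrightarrow>
           distr (M n) borel (X n e) = distr N borel (\<lambda>\<omega>. Z \<omega> powr s n)"
  shows "\<forall>\<epsilon>>0. with_high_probability M (\<lambda>n. {\<omega> \<in> space (M n).
           (1 - \<epsilon>) * exp (- \<gamma>) \<le> passage_weight n (\<lambda>e. X n e \<omega>) \<and>
           passage_weight n (\<lambda>e. X n e \<omega>) \<le> 1 + \<epsilon> \<and>
           real (hopcount n (\<lambda>e. X n e \<omega>)) \<le> exp (2 * \<gamma>)})"
proof (intro allI impI)
  fix \<epsilon> :: real
  assume \<epsilon>: "0 < \<epsilon>"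
  let ?A = "\<lambda>n. {\<omega> \<in> space (M n).
           (1 - \<epsilon>) * exp (- \<gamma>) \<le> passage_weight n (\<lambda>e. X n e \<omega>) \<and>
           passage_weight n (\<lambda>e. X n e \<omega>) \<le> 1 + \<epsilon> \<and>
           real (hopcount n (\<lambda>e. X n e \<omega>)) \<le> exp (2 * \<gamma>)}"
  \<comment> \<open>The margin \<open>d\<close> comes from integrality and depends on
    \<open>\<gamma>\<close> alone.\<close>
  obtain d where d: "0 < d" "d < 1"
    and hop: "\<And>k :: nat. (1 - d) * real k \<le> (1 + d) * exp (2 * \<gamma>) \<Longrightarrow> real k \<le> exp (2 * \<gamma>)"
    using nat_le_of_le_mult_near_1[of "exp (2 * \<gamma>)"] by auto
  \<comment> \<open>Both margins are respected, and \<open>d < 1\<close> keeps \<open>a\<close> and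
    \<open>b\<close> positive even when \<open>\<epsilon> \<ge> 1\<close>.\<close>
  define \<delta> where "\<delta> = min \<epsilon> d"
  have \<delta>: "0 < \<delta>" "\<delta> < 1" "\<delta> \<le> \<epsilon>" "\<delta> \<le> d"
    using \<epsilon> d by (auto simp: \<delta>_def)
  \<comment> \<open>The values \<open>a\<close> and \<open>b\<close> lie strictly below the critical
    \<open>exp (- \<gamma>)\<close> and \<open>exp (- (2 * \<gamma>))\<close>, and \<open>u\<close>
    strictly above 1, so each term of the failure bound \<open>q\<close> tends to 0.\<close>
  define a where "a = (1 - \<delta>) * exp (- \<gamma>)"
  define b where "b = (1 - \<delta>) * exp (- (2 * \<gamma>))"
  define u where "u = 1 + \<delta>"
  define q where "q n = real n * G (a powr (1 / s n)) + (real n)\<^sup>2 * G (b powr (1 / s n)) +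
      (1 - G (u powr (1 / s n)))" for n
  have abu: "0 < a" "0 < b" "0 < u" "1 < u"
    using \<delta> by (simp_all add: a_def b_def u_def)
  have a_lt: "a < exp (- (real 1 * \<gamma>))" and b_lt: "b < exp (- (real 2 * \<gamma>))"
    using \<delta> by (simp_all add: a_def b_def)
  have hop': "real k \<le> exp (2 * \<gamma>)" if "b * real k \<le> u" for k
  proof (rule hop)
    have "(1 - \<delta>) * real k = (b * real k) * exp (2 * \<gamma>)"
      by (simp add: b_def exp_minus field_simps)
    also have "\<dots> \<le> u * exp (2 * \<gamma>)"
      using that by simp
    finally have "(1 - \<delta>) * real k \<le> (1 + \<delta>) * exp (2 * \<gamma>)"
      by (simp add: u_def)
    moreover have "(1 - d) * real k \<le> (1 - \<delta>) * real k"
      "(1 + \<delta>) * exp (2 * \<gamma>) \<le> (1 + d) * exp (2 * \<gamma>)"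
      using \<delta> by (intro mult_right_mono; simp)+
    ultimately show "(1 - d) * real k \<le> (1 + d) * exp (2 * \<gamma>)"
      by linarith
  qed
  have s_pos: "\<forall>\<^sub>F n in sequentially. 0 < s n"
    using eventually_ge_at_top[of 1] by eventually_elim (rule assms(8))
  note lim = assms(10)
  have "(\<lambda>n. real n ^ 1 * G (a powr (1 / s n))) \<longlonglongrightarrow> 0"
    by (rule power_mult_cdf_powr_tendsto_zero[OF assms(7) s_pos lim \<open>0 \<le> \<gamma>\<close> abu(1) a_lt])
  moreover have "(\<lambda>n. (real n)\<^sup>2 * G (b powr (1 / s n))) \<longlonglongrightarrow> 0"
    by (rule power_mult_cdf_powr_tendsto_zero[OF assms(7) s_pos lim \<open>0 \<le> \<gamma>\<close> abu(2) b_lt])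
  moreover have "(\<lambda>n. G (u powr (1 / s n))) \<longlonglongrightarrow> 1"
    unfolding assms(4)
    by (rule cdf_powr_tendsto_one[OF assms(1,2) s_pos tendsto_zero_of_mult_ln[OF lim] abu(4)])
  ultimately have "q \<longlonglongrightarrow> 0 + 0 + (1 - 1)"
    unfolding q_def by (intro tendsto_intros) simp_all
  then have q_lim: "(\<lambda>n. 1 - q n) \<longlonglongrightarrow> 1"
    using tendsto_diff[OF tendsto_const, of q 0 sequentially 1] by simp
  \<comment> \<open>From \<open>n = 2\<close> on, the edge \<open>{1, 2}\<close> is present.\<close>
  have lower: "1 - q n \<le> measure (M n) (?A n)" if n: "2 \<le> n" for n
  proof -
    interpret prob_space "M n"
      using assms(11) n by simp
    have X: "X n e \<in> borel_measurable (M n)" if "e \<in> K_edges n" for e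
      using assms(12)[of n] n that by (auto simp: indep_vars_def)
    have sn: "0 < s n"
      using assms(8) n by simp
    have eq: "distr (M n) borel (X n e) = distr N borel (\<lambda>\<omega>. Z \<omega> powr s n)"
      if "e \<in> K_edges n" for e
      using assms(13) n that by simp
    note tails = measure_powr_tails[OF assms(1-3) X eq sn, folded assms(4)]
    have nonneg: "0 \<le> G x" for x
      by (simp add: assms(4))
    have "1 - q n \<le> measure (M n) {\<omega> \<in> space (M n).
        a \<le> passage_weight n (\<lambda>e. X n e \<omega>) \<and> passage_weight n (\<lambda>e. X n e \<omega>) \<le> u \<and>
        real (hopcount n (\<lambda>e. X n e \<omega>)) \<le> exp (2 * \<gamma>)}"
      unfolding q_def
      using abu by (intro prob_passage_weight_hopcount_ge[where b = b] prob_space_axioms n X tails hop' nonneg)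
        auto
    also have "\<dots> \<le> measure (M n) (?A n)"
    proof (rule finite_measure_mono)
      note [measurable] = measurable_passage_weight[OF X] measurable_hopcount[OF X]
      \<comment> \<open>Monotonicity of the measure requires the larger event to be
        measurable.\<close>
      show "?A n \<in> sets (M n)"
        by measurable
      have "(1 - \<epsilon>) * exp (- \<gamma>) \<le> a" "u \<le> 1 + \<epsilon>"
        using \<delta> by (simp_all add: a_def u_def)
      then show "{\<omega> \<in> space (M n).
          a \<le> passage_weight n (\<lambda>e. X n e \<omega>) \<and> passage_weight n (\<lambda>e. X n e \<omega>) \<le> u \<and>
          real (hopcount n (\<lambda>e. X n e \<omega>)) \<le> exp (2 * \<gamma>)} \<subseteq> ?A n"
        by auto
    qed
    finally show ?thesis .
  qed
  show "with_high_probability M ?A"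
    unfolding with_high_probability_def
  proof (rule tendsto_sandwich[OF _ _ q_lim tendsto_const])
    show "\<forall>\<^sub>F n in sequentially. 1 - q n \<le> measure (M n) (?A n)"
      using eventually_ge_at_top[of 2] by eventually_elim (rule lower)
    show "\<forall>\<^sub>F n in sequentially. measure (M n) (?A n) \<le> 1"
      using eventually_ge_at_top[of 1]
      by eventually_elim (rule prob_space.prob_le_1[OF assms(11)])
  qed
qed

end
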